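(* Let $a,b$ be nonzero real numbers, let $(\mathcal{F}_n(a,b))$ be the bi-periodic Fibonacci matrix sequence and $(\mathcal{L}_n(a,b))$ the bi-periodic Lucas matrix sequence. Then for every $n\in\mathbb{N}$: (i) $\displaystyle \mathcal{L}_{n-1}(a,b)+\mathcal{L}_{n+1}(a,b)=\frac{a}{b}(ab+4)\,\mathcal{F}_n(a,b)$; (ii) $\displaystyle \mathcal{F}_{n-1}(a,b)+\mathcal{F}_{n+1}(a,b)=\frac{b}{a}\,\mathcal{L}_n(a,b)$.
   Context: Let $a,b$ be nonzero real numbers and $\mathbb{N}=\{0,1,2,\dots\}$. Put $\varepsilon(n)=1$ if $n$ is odd and $\varepsilon(n)=0$ if $n$ is even. The bi-periodic Fibonacci numbers are defined by $q_0=0$, $q_1=1$, and $q_n=a\,q_{n-1}+q_{n-2}$ if $n$ is even, $q_n=b\,q_{n-1}+q_{n-2}$ if $n$ is odd. The bi-periodic Fibonacci matrix sequence is $$\mathcal{F}_n(a,b)=\begin{pmatrix} \left(\frac{b}{a}\right)^{\varepsilon(n)} q_{n+1} & \frac{b}{a}\,q_n\\ q_n & \left(\frac{b}{a}\right)^{\varepsilon(n)} q_{n-1}\end{pmatrix}.$$ The bi-periodic Lucas matrix sequence is defined by $$\mathcal{L}_0(a,b)=\begin{pmatrix} a & 2\\ 2\frac{a}{b} & -a\end{pmatrix},\qquad \mathcal{L}_1(a,b)=\begin{pmatrix} a^2+2\frac{a}{b} & a\\ \frac{a^2}{b} & 2\frac{a}{b}\end{pmatrix},$$ and $\mathcal{L}_n(a,b)=a\,\mathcal{L}_{n-1}(a,b)+\mathcal{L}_{n-2}(a,b)$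 if $n$ is odd, $\mathcal{L}_n(a,b)=b\,\mathcal{L}_{n-1}(a,b)+\mathcal{L}_{n-2}(a,b)$ if $n$ is even. Terms with negative index are defined by running the recurrences backwards: $q_{-1}=1$, $q_{-2}=-a$, $\mathcal{L}_{-1}(a,b)=\mathcal{L}_1(a,b)-a\,\mathcal{L}_0(a,b)$, and $\mathcal{F}_{-1}(a,b)$ is given by the displayed formula with $n=-1$. *)

theory Defs
  imports "HOL-Analysis.Analysis"
begin

text \<open>
  All sequences are indexed by \<open>int\<close>, since terms of index \<open>-1\<close> (and \<open>-2\<close>) are needed.
  The last equation of each recursive definition is the recurrence solved for its term of
  lowest index; the parity of \<open>n + 2\<close> is that of \<open>n\<close>.
\<close>

definition parity :: "int \<Rightarrow> nat" ("\<epsilon>") where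
  "\<epsilon> n = (if odd n then 1 else 0)"

function bifib :: "real \<Rightarrow> real \<Rightarrow> int \<Rightarrow> real" where
  "bifib a b n =
    (if n = 0 then 0
     else if n = 1 then 1
     else if n \<ge> 2 then (if even n then a else b) * bifib a b (n - 1) + bifib a b (n - 2)
     else bifib a b (n + 2) - (if even n then a else b) * bifib a b (n + 1))"
  by pat_completeness auto
termination
  by (relation "Wellfounded.measure (\<lambda>(a, b, n). nat (if n \<ge> 0 then n else 1 - n))") auto

declare bifib.simps [simp del]

definition fib_matrix :: "real \<Rightarrow> real \<Rightarrow> int \<Rightarrow> real^2^2" ("\<F>") where
  "\<F> a b n = vector
    [vector [(b / a) ^ \<epsilon> n * bifib a b (n + 1), b / a * bifib a b n],
     vector [bifib a b n, (b / a) ^ \<epsilon> n * bifib a b (n - 1)]]"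

function luc_matrix :: "real \<Rightarrow> real \<Rightarrow> int \<Rightarrow> real^2^2" ("\<L>") where
  "luc_matrix a b n =
    (if n = 0 then vector [vector [a, 2], vector [2 * (a / b), - a]]
     else if n = 1 then vector [vector [a\<^sup>2 + 2 * (a / b), a], vector [a\<^sup>2 / b, 2 * (a / b)]]
     else if n \<ge> 2 then
       (if odd n then a else b) *\<^sub>R luc_matrix a b (n - 1) + luc_matrix a b (n - 2)
     else luc_matrix a b (n + 2) - (if odd n then a else b) *\<^sub>R luc_matrix a b (n + 1))"
  by pat_completeness auto
termination
  by (relation "Wellfounded.measure (\<lambda>(a, b, n). nat (if n \<ge> 0 then n else 1 - n))") auto

declare luc_matrix.simps [simp del]

lemma bifib_rec: "bifib a b n = (if even n then a else b) * bifib a b (n - 1) + bifib a b (n - 2)"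
proof (cases "n \<ge> 2")
  case True
  then show ?thesis by (subst bifib.simps) simp
next
  case False
  then show ?thesis
    using bifib.simps[of a b "n - 2"] by simp
qed

lemma luc_matrix_rec: "\<L> a b n = (if odd n then a else b) *\<^sub>R \<L> a b (n - 1) + \<L> a b (n - 2)"
proof (cases "n \<ge> 2")
  case True
  then show ?thesis by (subst luc_matrix.simps) simp
next
  case False
  then show ?thesis
    using luc_matrix.simps[of a b "n - 2"] by simp
qed

lemma bifib_0: "bifib a b 0 = 0"
  and bifib_1: "bifib a b 1 = 1"
  by (simp_all add: bifib.simps)

lemma bifib_minus_1: "bifib a b (-1) = 1"
  using bifib_rec[of a b 1] by (simp add: bifib_0 bifib_1)

lemma bifib_minus_2: "bifib a b (-2) = - a"
  using bifib_rec[of a b 0] by (simp add: bifib_0 bifib_minus_1)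

lemma luc_matrix_minus_1: "\<L> a b (-1) = \<L> a b 1 - a *\<^sub>R \<L> a b 0"
  using luc_matrix_rec[of a b 1] by simp

end

theory Submission
  imports Defs
begin

text \<open>
  Both sides of (i) solve the recurrence of \<open>\<F>\<close>, and both sides of (ii) solve the recurrence
  of \<open>\<L>\<close>: passing from \<open>X n\<close> to \<open>X (n - 1) + X (n + 1)\<close> exchanges the roles of \<open>a\<close> and \<open>b\<close>.
  A solution is determined by its values at \<open>0\<close> and \<open>1\<close>, so it is enough to compare these.
\<close>

lemma second_order_recurrence_unique:
  fixes X Y :: "int \<Rightarrow> 'a::real_vector"
  assumes "\<And>k. X k = c k *\<^sub>R X (k - 1) + X (k - 2)"
    and "\<And>k. Y k = c k *\<^sub>R Y (k - 1) + Y (k - 2)"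
    and "X 0 = Y 0" and "X 1 = Y 1"
  shows "X (int n) = Y (int n)"
proof (induction n rule: less_induct)
  case (less n)
  consider "n = 0" | "n = 1" | "n \<ge> 2" by linarith
  then show ?case
  proof cases
    case 3
    \<comment> \<open>Subtraction on \<open>nat\<close> is truncated; \<open>n \<ge> 2\<close> makes
      it agree with the subtraction on \<open>int\<close> in the recurrence.\<close>
    then have "int (n - 1) = int n - 1" "int (n - 2) = int n - 2" by auto
    with less.IH[of "n - 1"] less.IH[of "n - 2"] 3
    have "X (int n - 1) = Y (int n - 1)" "X (int n - 2) = Y (int n - 2)" by auto
    then show ?thesis using assms(1,2)[of "int n"] by simp
  qed (use assms(3,4) in auto)
qed

text \<open>The indices \<open>k - 1\<close> and \<open>k + 1\<close> share the parity opposite to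
  that of \<open>k\<close>, so their two recurrences carry the same coefficient and can be added;
  this swaps \<open>p\<close> and \<open>q\<close>. The indices on the right stay unsimplified, to
  read as the neighbour sum taken at \<open>k - 1\<close> and \<open>k - 2\<close>.\<close>

lemma neighbour_sum_rec:
  fixes X :: "int \<Rightarrow> 'a::real_vector"
  assumes "\<And>k. X k = (if even k then p else q) *\<^sub>R X (k - 1) + X (k - 2)"
  shows "X (k - 1) + X (k + 1) =
    (if even k then q else p) *\<^sub>R (X (k - 1 - 1) + X (k - 1 + 1)) + (X (k - 2 - 1) + X (k - 2 + 1))"
  using assms[of "k - 1"] assms[of "k + 1"] by (auto simp: algebra_simps)

lemma mat2_eq_iff:
  fixes A B :: "'a^2^2"
  shows "A = B \<longleftrightarrow>
    A $ 1 $ 1 = B $ 1 $ 1 \<and> A $ 1 $ 2 = B $ 1 $ 2 \<and> A $ 2 $ 1 = B $ 2 $ 1 \<and> A $ 2 $ 2 = B $ 2 $ 2"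
  by (simp add: vec_eq_iff forall_2)

text \<open>The lower left and upper right entries follow the recurrence of \<open>bifib\<close> at
  \<open>n\<close>. On the diagonal the indices \<open>n + 1\<close> and \<open>n - 1\<close> have
  the other parity, and the power of \<open>b / a\<close> makes up for the swapped coefficient,
  since \<open>a * (b / a) = b\<close>.\<close>

lemma fib_matrix_rec:
  assumes "a \<noteq> 0"
  shows "\<F> a b n = (if even n then a else b) *\<^sub>R \<F> a b (n - 1) + \<F> a b (n - 2)"
  using assms bifib_rec[of a b "n + 1"] bifib_rec[of a b n] bifib_rec[of a b "n - 1"]
  by (auto simp: mat2_eq_iff fib_matrix_def parity_def field_simps)

lemma bifib_2: "bifib a b 2 = a"
  using bifib_rec[of a b 2] by (simp add: bifib_0 bifib_1)

lemma luc_matrix_0: "\<L> a b 0 = vector [vector [a, 2], vector [2 * (a / b), - a]]"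
  and luc_matrix_1:
    "\<L> a b 1 = vector [vector [a\<^sup>2 + 2 * (a / b), a], vector [a\<^sup>2 / b, 2 * (a / b)]]"
  by (simp_all add: luc_matrix.simps)

theorem theorem2p4:
  fixes a b :: real and n :: nat
  assumes "a \<noteq> 0" and "b \<noteq> 0"
  shows "\<L> a b (int n - 1) + \<L> a b (int n + 1) = (a / b * (a * b + 4)) *\<^sub>R \<F> a b (int n) \<and>
         \<F> a b (int n - 1) + \<F> a b (int n + 1) = (b / a) *\<^sub>R \<L> a b (int n)"
proof
  \<comment> \<open>Put in terms of \<open>even\<close>, the recurrence has the form used for
    neighbour sums, with \<open>b\<close> and \<open>a\<close> in the opposite places to those for
    \<open>\<F>\<close>.\<close>
  have L_rec: "\<L> a b k = (if even k then b else a) *\<^sub>R \<L> a b (k - 1) + \<L> a b (k - 2)" for k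
    using luc_matrix_rec[of a b k] by simp
  note F_rec = fib_matrix_rec[OF assms(1), of b]
  have L_2: "\<L> a b 2 = b *\<^sub>R \<L> a b 1 + \<L> a b 0"
    using L_rec[of 2] by simp
  have F_0: "\<F> a b 0 = vector [vector [1, 0], vector [0, 1]]"
    by (simp add: fib_matrix_def parity_def bifib_0 bifib_1 bifib_minus_1)
  have F_1: "\<F> a b 1 = vector [vector [b, b / a], vector [1, 0]]"
    using assms by (simp add: fib_matrix_def parity_def bifib_0 bifib_1 bifib_2)
  have F_minus_1: "\<F> a b (-1) = \<F> a b 1 - b *\<^sub>R \<F> a b 0"
    using F_rec[of 1] by simp
  have F_2: "\<F> a b 2 = a *\<^sub>R \<F> a b 1 + \<F> a b 0"
    using F_rec[of 2] by simp

  \<comment> \<open>Since \<open>\<F> a b 0\<close> is the identity matrix, the factor can be read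
    off at index 0, where the neighbour sum is
    \<open>2 *\<^sub>R \<L> a b 1 - a *\<^sub>R \<L> a b 0\<close>.\<close>
  let ?s = "a / b * (a * b + 4)"
  show "\<L> a b (int n - 1) + \<L> a b (int n + 1) = ?s *\<^sub>R \<F> a b (int n)"
  proof (rule second_order_recurrence_unique)
    show "\<L> a b (k - 1) + \<L> a b (k + 1) = (if even k then a else b) *\<^sub>R
      (\<L> a b (k - 1 - 1) + \<L> a b (k - 1 + 1)) + (\<L> a b (k - 2 - 1) + \<L> a b (k - 2 + 1))" for k
      by (rule neighbour_sum_rec[OF L_rec])
    show "?s *\<^sub>R \<F> a b k =
      (if even k then a else b) *\<^sub>R (?s *\<^sub>R \<F> a b (k - 1)) + ?s *\<^sub>R \<F> a b (k - 2)" for k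
      by (subst F_rec) (simp only: scaleR_add_right scaleR_left_commute)
    show "\<L> a b (0 - 1) + \<L> a b (0 + 1) = ?s *\<^sub>R \<F> a b 0"
      using assms
      by (simp add: luc_matrix_minus_1 luc_matrix_0 luc_matrix_1 F_0 mat2_eq_iff
          field_simps power2_eq_square)
    show "\<L> a b (1 - 1) + \<L> a b (1 + 1) = ?s *\<^sub>R \<F> a b 1"
      using assms
      by (simp add: L_2 luc_matrix_0 luc_matrix_1 F_1 mat2_eq_iff field_simps power2_eq_square)
  qed

  show "\<F> a b (int n - 1) + \<F> a b (int n + 1) = (b / a) *\<^sub>R \<L> a b (int n)"
  proof (rule second_order_recurrence_unique)
    show "\<F> a b (k - 1) + \<F> a b (k + 1) = (if even k then b else a) *\<^sub>R
      (\<F> a b (k - 1 - 1) + \<F> a b (k - 1 + 1)) + (\<F> a b (k - 2 - 1) + \<F> a b (k - 2 + 1))" for k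
      by (rule neighbour_sum_rec[OF F_rec])
    \<comment> \<open>By linearity, a constant multiple of a solution is again a solution.\<close>
    show "(b / a) *\<^sub>R \<L> a b k =
      (if even k then b else a) *\<^sub>R ((b / a) *\<^sub>R \<L> a b (k - 1)) + (b / a) *\<^sub>R \<L> a b (k - 2)" for k
      by (subst L_rec) (simp only: scaleR_add_right scaleR_left_commute)
    show "\<F> a b (0 - 1) + \<F> a b (0 + 1) = (b / a) *\<^sub>R \<L> a b 0"
      using assms by (simp add: F_minus_1 F_0 F_1 luc_matrix_0 mat2_eq_iff field_simps)
    show "\<F> a b (1 - 1) + \<F> a b (1 + 1) = (b / a) *\<^sub>R \<L> a b 1"
      using assms by (simp add: F_2 F_0 F_1 luc_matrix_1 mat2_eq_iff field_simps power2_eq_square)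
  qed
qed

end
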